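(* If $G$ and $H$ are connected triangle-free graphs of order at least $3$, then $$\mathrm{mp}(G\,\square\,H)\le \max\{2,\ \sigma(G)\Delta(H),\ \sigma(H)\Delta(G)\}.$$
   Context: All graphs are finite, simple and undirected. A path in a graph is monophonic (induced) if there are no edges between non-consecutive vertices of the path. A set $M$ of vertices of a graph is a monophonic position set if no three distinct vertices of $M$ lie on a common monophonic path; $\mathrm{mp}(G)$ is the largest cardinality of a monophonic position set of $G$. $\Delta(G)$ is the maximum degree. A vertex is simplicial if its neighbourhood induces a clique; $\sigma(G)=1$ if $G$ contains at least one simplicial vertex and $\sigma(G)=0$ otherwise. The Cartesian product $G\,\square\,H$ has vertex set $V(G)\times V(H)$, with $(g_1,h_1)$ and $(g_2,h_2)$ adjacent iff ($g_1\sim g_2$ in $G$ and $h_1=h_2$) or ($g_1=g_2$ and $h_1\sim h_2$ in $H$). *)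

theory Defs
  imports "Graph_Theory.Graph_Theory"
begin

text \<open>
  A finite simple undirected graph is a \<open>pair_graph\<close>: a finite loop-free digraph
  whose arcs are a symmetric set of ordered pairs of vertices. Each undirected edge
  is thus present as two opposite arcs.
\<close>

definition triangle_free :: "'a pair_pre_digraph \<Rightarrow> bool" where
  "triangle_free G \<longleftrightarrow>
     \<not> (\<exists>u v w. (u, v) \<in> parcs G \<and> (v, w) \<in> parcs G \<and> (u, w) \<in> parcs G)"

text \<open>
  As every edge gives one arc in each direction, the degree of a vertex is its out-degree.
\<close>

definition max_degree :: "'a pair_pre_digraph \<Rightarrow> nat" where
  "max_degree G = Max (out_degree (with_proj G) ` pverts G)"

definition nbhd :: "'a pair_pre_digraph \<Rightarrow> 'a \<Rightarrow> 'a set" where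
  "nbhd G v = {u. (v, u) \<in> parcs G}"

definition simplicial :: "'a pair_pre_digraph \<Rightarrow> 'a \<Rightarrow> bool" where
  "simplicial G v \<longleftrightarrow> v \<in> pverts G \<and>
     (\<forall>x\<in>nbhd G v. \<forall>y\<in>nbhd G v. x \<noteq> y \<longrightarrow> (x, y) \<in> parcs G)"

definition simplicial_indicator :: "'a pair_pre_digraph \<Rightarrow> nat" where
  "simplicial_indicator G = (if \<exists>v. simplicial G v then 1 else 0)"

definition monophonic_path :: "'a pair_pre_digraph \<Rightarrow> 'a list \<Rightarrow> bool" where
  "monophonic_path G p \<longleftrightarrow> vpath p (with_proj G) \<and>
     (\<forall>i j. Suc i < j \<and> j < length p \<longrightarrow> (p ! i, p ! j) \<notin> parcs G)"

definition monophonic_position_set :: "'a pair_pre_digraph \<Rightarrow> 'a set \<Rightarrow> bool" where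
  "monophonic_position_set G M \<longleftrightarrow> M \<subseteq> pverts G \<and>
     \<not> (\<exists>x\<in>M. \<exists>y\<in>M. \<exists>z\<in>M. x \<noteq> y \<and> y \<noteq> z \<and> x \<noteq> z \<and>
          (\<exists>p. monophonic_path G p \<and> {x, y, z} \<subseteq> set p))"

definition mp_number :: "'a pair_pre_digraph \<Rightarrow> nat" where
  "mp_number G = Max {card M | M. monophonic_position_set G M}"

definition cartesian_product ::
  "'a pair_pre_digraph \<Rightarrow> 'b pair_pre_digraph \<Rightarrow> ('a \<times> 'b) pair_pre_digraph" where
  "cartesian_product G H = \<lparr> pverts = pverts G \<times> pverts H,
     parcs = {((g1, h1), (g2, h2)) | g1 h1 g2 h2.
       (g1, g2) \<in> parcs G \<and> h1 \<in> pverts H \<and> h1 = h2 \<or>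
       g1 \<in> pverts G \<and> g1 = g2 \<and> (h1, h2) \<in> parcs H} \<rparr>"

lemma pair_graph_cartesian_product:
  assumes "pair_graph G" and "pair_graph H"
  shows "pair_graph (cartesian_product G H)"
proof -
  interpret G: pair_graph G by fact
  interpret H: pair_graph H by fact
  let ?P = "cartesian_product G H"
  have sub: "parcs ?P \<subseteq> pverts ?P \<times> pverts ?P"
    by (auto simp: cartesian_product_def dest: G.wellformed' H.wellformed')
  have finV: "finite (pverts ?P)"
    by (simp add: cartesian_product_def G.pair_finite_verts H.pair_finite_verts)
  have finA: "finite (parcs ?P)"
    using sub finV by (meson finite_SigmaI finite_subset)
  have symA: "sym (parcs ?P)"
    by (auto simp: cartesian_product_def sym_def dest: G.arcs_symmetric H.arcs_symmetric)
  have irr: "fst e \<noteq> snd e" if "e \<in> parcs ?P" for e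
    using that by (auto simp: cartesian_product_def dest: G.no_loops' H.no_loops')
  show ?thesis
    by unfold_locales (use sub finV finA symA irr in \<open>auto simp: symmetric_def\<close>)
qed

lemma mp_number_attained:
  assumes "pair_graph G"
  shows "\<exists>M. monophonic_position_set G M \<and> card M = mp_number G"
    and "monophonic_position_set G M \<Longrightarrow> card M \<le> mp_number G"
proof -
  interpret pair_graph G by fact
  let ?S = "{card M | M. monophonic_position_set G M}"
  have "?S \<subseteq> card ` Pow (pverts G)"
    by (auto simp: monophonic_position_set_def)
  then have fin: "finite ?S"
    by (rule finite_subset) (simp add: pair_finite_verts)
  have "monophonic_position_set G {}"
    by (simp add: monophonic_position_set_def)
  then have "?S \<noteq> {}"
    by blast
  from Max_in[OF fin this]
  show "\<exists>M. monophonic_position_set G M \<and> card M = mp_number G"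
    by (auto simp: mp_number_def)
  show "monophonic_position_set G M \<Longrightarrow> card M \<le> mp_number G"
    unfolding mp_number_def by (rule Max_ge[OF fin]) blast
qed

end

theory Submission
  imports Defs
begin

text \<open>
  Call three vertices collinear if one induced path contains all of them. The upper bound comes
  from showing that almost every triple of the product is collinear.

  Induced paths of the product are assembled from segments that run inside one layer, alternately
  along an induced path of \<open>G\<close> and along one of \<open>H\<close>. If three vertices have collinear
  projections, with distinct images, in one factor, then a path shaped like a square bracket
  contains them (\<open>bracket\<close>, \<open>collinear_lift_G\<close>). Otherwise the projections to that factor are
  pairwise nonadjacent, because in a connected triangle-free graph an adjacent pair is collinear
  with every third vertex (\<open>adjacent_imp_collinear\<close>), and an induced path between two of them
  misses the third. This absence of adjacencies is exactly what makes suitable zigzag paths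
  induced: every triple with three distinct coordinates in both factors is collinear
  (\<open>distinct_coordinates\<close>), and so is every triple with exactly two vertices in a common layer
  (\<open>corner\<close>, \<open>two_in_layer\<close>). Hence a monophonic position set with at least three elements
  lies in a single layer, say \<open>{g} \<times> K\<close>.

  Within a layer a triple can still be joined by leaving the layer. If \<open>g\<close> has two neighbours,
  one detour is made through each of them. If \<open>g\<close> is a leaf, there is a path \<open>g, g1, g2\<close>, and one
  detour through the layer of \<open>g2\<close> works unless the third vertex has a neighbour on the chosen path
  between the first two (\<open>same_layer\<close>). So \<open>g\<close> is simplicial, and every induced path between two
  vertices of \<open>K\<close> is adjacent to all other vertices of \<open>K\<close>. A shortest such path then has a
  single interior vertex, whose neighbourhood contains \<open>K\<close>
  (\<open>dominated_set_in_neighbourhood\<close>); therefore \<open>card K \<le> \<Delta>(H)\<close>.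
\<close>

section \<open>Induced paths by their vertex sets\<close>

text \<open>
  Only the end vertices and the vertex set of an induced path matter below. Recording these,
  instead of a list, turns the question whether two paths can be concatenated into a condition
  on pairs of vertices.
\<close>

inductive induced_path :: "'a pair_pre_digraph \<Rightarrow> 'a \<Rightarrow> 'a \<Rightarrow> 'a set \<Rightarrow> bool" for G where
  single: "v \<in> pverts G \<Longrightarrow> induced_path G v v {v}"
| step: "\<lbrakk>(a, c) \<in> parcs G; induced_path G c b T; a \<in> pverts G; a \<notin> T;
    \<forall>t\<in>T - {c}. (a, t) \<notin> parcs G\<rbrakk> \<Longrightarrow> induced_path G a b (insert a T)"

text \<open>
  The condition under which two induced paths with common end \<open>c\<close> form an induced path together.
\<close>

definition separated :: "'a pair_pre_digraph \<Rightarrow> 'a set \<Rightarrow> 'a set \<Rightarrow> 'a \<Rightarrow> bool" where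
  "separated G S T c \<longleftrightarrow> (\<forall>s\<in>S - {c}. \<forall>t\<in>T - {c}. s \<noteq> t \<and> (s, t) \<notin> parcs G)"

definition collinear :: "'a pair_pre_digraph \<Rightarrow> 'a \<Rightarrow> 'a \<Rightarrow> 'a \<Rightarrow> bool" where
  "collinear G a b c \<longleftrightarrow> (\<exists>u v S. induced_path G u v S \<and> {a, b, c} \<subseteq> S)"

definition between :: "'a pair_pre_digraph \<Rightarrow> 'a \<Rightarrow> 'a \<Rightarrow> 'a \<Rightarrow> bool" where
  "between G a c b \<longleftrightarrow>
     (\<exists>S T. induced_path G a c S \<and> induced_path G c b T \<and> separated G S T c)"

lemma collinearI: "induced_path G u v S \<Longrightarrow> a \<in> S \<Longrightarrow> b \<in> S \<Longrightarrow> c \<in> S \<Longrightarrow> collinear G a b c"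
  unfolding collinear_def by blast

lemma collinear_swap12: "collinear G a b c \<Longrightarrow> collinear G b a c"
  and collinear_swap23: "collinear G a b c \<Longrightarrow> collinear G a c b"
  unfolding collinear_def by blast+

lemma induced_path_ends: "induced_path G a b S \<Longrightarrow> a \<in> S \<and> b \<in> S"
  by (induction rule: induced_path.induct) auto

lemma induced_path_subset: "induced_path G a b S \<Longrightarrow> S \<subseteq> pverts G"
  by (induction rule: induced_path.induct) auto

lemma induced_path_finite: "induced_path G a b S \<Longrightarrow> finite S"
  by (induction rule: induced_path.induct) auto

lemma induced_path_monophonic:
  assumes "induced_path G a b S"
  shows "\<exists>p. monophonic_path G p \<and> hd p = a \<and> set p = S"
  using assms
proof (induction rule: induced_path.induct)
  case (single v)
  then show ?case
    by (intro exI[of _ "[v]"]) (auto simp: monophonic_path_def intro!: vpathI vwalkI)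
next
  case (step a c b T)
  then obtain p where p: "monophonic_path G p" "hd p = c" "set p = T" by blast
  then have vp: "vwalk p (with_proj G)" "distinct p"
    and ind: "\<And>i j. Suc i < j \<Longrightarrow> j < length p \<Longrightarrow> (p ! i, p ! j) \<notin> parcs G"
    by (auto simp: monophonic_path_def elim: vpathE)
  then obtain q where q: "p = c # q" using p(2) by (cases p) (auto elim: vwalkE)
  have "vwalk (a # p) (with_proj G)" using vp step.hyps p(2) by (intro vwalk_consI) auto
  moreover have "((a # p) ! i, (a # p) ! j) \<notin> parcs G" if ij: "Suc i < j" "j < length (a # p)" for i j
  proof (cases i)
    case 0
    then obtain j' where j': "j = Suc (Suc j')" using ij by (metis Suc_lessE less_imp_Suc_add)
    then have "j' < length q" using ij q by auto
    then have "p ! Suc j' \<in> T - {c}"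
      using vp(2) p(3) q by auto
    then show ?thesis using 0 j' step.hyps by simp
  next
    case (Suc i')
    then obtain j' where "j = Suc j'" using ij by (cases j) auto
    then show ?thesis using Suc ij ind by simp
  qed
  ultimately show ?case using p vp step.hyps
    by (intro exI[of _ "a # p"]) (auto simp: monophonic_path_def intro!: vpathI)
qed

context pair_graph
begin

lemma induced_path_edge: "(a, b) \<in> parcs G \<Longrightarrow> induced_path G a b {a, b}"
  by (rule induced_path.step[OF _ induced_path.single]) (auto dest: wellformed' no_loops')

lemma induced_path_join:
  assumes "induced_path G a c S" "induced_path G c b T" "separated G S T c"
  shows "induced_path G a b (S \<union> T)"
  using assms
proof (induction rule: induced_path.induct)
  case (single v)
  then show ?case using induced_path_ends by (metis insert_absorb insert_is_Un)
next
  case (step a d c S)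
  have cS: "c \<in> S" "c \<in> T" using step.hyps step.prems induced_path_ends by metis+
  have "separated G S T c" using step.prems(2) unfolding separated_def by blast
  then have "induced_path G d b (S \<union> T)" by (rule step.IH[OF step.prems(1)])
  moreover have "a \<notin> S \<union> T" "\<forall>t\<in>S \<union> T - {d}. (a, t) \<notin> parcs G"
    using step.hyps step.prems(2) cS unfolding separated_def by blast+
  ultimately have "induced_path G a b (insert a (S \<union> T))"
    by (rule induced_path.step[OF step.hyps(1) _ step.hyps(3)])
  then show ?case by simp
qed

lemma induced_path_rev: "induced_path G a b S \<Longrightarrow> induced_path G b a S"
proof (induction rule: induced_path.induct)
  case (single v)
  then show ?case by (rule induced_path.single)
next
  case (step a c b T)
  have "induced_path G b a (T \<union> {c, a})"
    using step.hyps
    by (intro induced_path_join[OF step.IH induced_path_edge])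
       (auto simp: separated_def dest: arcs_symmetric)
  moreover have "T \<union> {c, a} = insert a T"
    using induced_path_ends[OF step.IH] by blast
  ultimately show ?case by simp
qed

lemma induced_path_split:
  assumes "induced_path G a b S" "c \<in> S"
  obtains S1 S2 where "S = S1 \<union> S2" "induced_path G a c S1" "induced_path G c b S2"
    "separated G S1 S2 c"
proof -
  from assms have "\<exists>S1 S2. S = S1 \<union> S2 \<and> induced_path G a c S1 \<and> induced_path G c b S2 \<and>
    separated G S1 S2 c"
  proof (induction rule: induced_path.induct)
    case (single v)
    then show ?case
      by (intro exI[of _ "{v}"]) (auto intro: induced_path.single simp: separated_def)
  next
    case (step a d b T)
    show ?case
    proof (cases "c = a")
      case True
      moreover have "induced_path G a b (insert a T)"
        using induced_path.step step.hyps by metis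
      ultimately show ?thesis using induced_path.single[OF step.hyps(3)]
        by (intro exI[of _ "{a}"] exI[of _ "insert a T"]) (simp add: separated_def)
    next
      case False
      then have "c \<in> T" using step.prems by simp
      then obtain S1 S2 where S: "T = S1 \<union> S2" "induced_path G d c S1" "induced_path G c b S2"
        "separated G S1 S2 c" using step.IH by (elim exE conjE meta_impE)
      have d: "d \<in> S1" using S induced_path_ends by metis
      have cS: "c \<in> S1" "c \<in> S2" using S induced_path_ends by metis+
      have "induced_path G a c (insert a S1)" using step.hyps S by (intro induced_path.step) auto
      moreover have "separated G (insert a S1) S2 c"
        using S(1,4) step.hyps d cS unfolding separated_def by auto
      ultimately show ?thesis using S(1,3)
        by (intro exI[of _ "insert a S1"] exI[of _ S2]) simp
    qed
  qed
  then show ?thesis using that by (elim exE conjE)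
qed

lemma induced_subpath:
  assumes "induced_path G u v S" "a \<in> S" "b \<in> S"
  obtains T where "T \<subseteq> S" "induced_path G a b T"
proof -
  obtain S1 S2 where S: "S = S1 \<union> S2" "induced_path G u a S1" "induced_path G a v S2"
    "separated G S1 S2 a"
    by (rule induced_path_split[OF assms(1,2)])
  show ?thesis
  proof (cases "b \<in> S1")
    case True
    obtain T1 T2 where T: "S1 = T1 \<union> T2" "induced_path G u b T1" "induced_path G b a T2"
      "separated G T1 T2 b" by (rule induced_path_split[OF S(2) True])
    show ?thesis using that[OF _ induced_path_rev[OF T(3)]] S(1) T(1) by blast
  next
    case False
    then have "b \<in> S2" using S(1) assms(3) by simp
    then obtain T1 T2 where T: "S2 = T1 \<union> T2" "induced_path G a b T1" "induced_path G b v T2"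
      "separated G T1 T2 b" by (rule induced_path_split[OF S(3)])
    show ?thesis using that[OF _ T(2)] S(1) T(1) by blast
  qed
qed

text \<open>
  To extend an induced path by a vertex \<open>a\<close> outside it, jump from \<open>a\<close> to the last of its neighbours on the
  path and drop everything before that. The start \<open>c\<close> of the old path survives only if it is itself
  the last neighbour of \<open>a\<close>.
\<close>

lemma induced_path_prepend:
  assumes "induced_path G c b T" "a \<in> pverts G" "a \<notin> T" "\<exists>t\<in>T. (a, t) \<in> parcs G"
  shows "\<exists>S\<subseteq>insert a T. induced_path G a b S \<and> ((a, c) \<in> parcs G \<or> c \<notin> S)"
  using assms
proof (induction rule: induced_path.induct)
  case (single v)
  then show ?case using induced_path_edge[of a v] by blast
next
  case (step c d b T)
  show ?case
  proof (cases "\<exists>t\<in>T. (a, t) \<in> parcs G")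
    case True
    then obtain S where "S \<subseteq> insert a T" "induced_path G a b S"
      using step by blast
    then show ?thesis using step.hyps step.prems by blast
  next
    case False
    then have "(a, c) \<in> parcs G" using step.prems by blast
    moreover have "induced_path G a b (insert a (insert c T))"
      by (rule induced_path.step[OF \<open>(a, c) \<in> parcs G\<close> induced_path.step[of c d]])
         (use step.hyps step.prems False in auto)
    ultimately show ?thesis by blast
  qed
qed

lemma separated_sym: "separated G S T c \<Longrightarrow> separated G T S c"
  unfolding separated_def by (auto dest: arcs_symmetric)

lemma separated_mono: "separated G S T c \<Longrightarrow> S' \<subseteq> S \<Longrightarrow> T' \<subseteq> T \<Longrightarrow> separated G S' T' c"
  unfolding separated_def by blast

lemma between_sym: "between G a c b \<Longrightarrow> between G b c a"
  unfolding between_def using separated_sym induced_path_rev by meson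

lemma betweenI:
  "induced_path G a c S \<Longrightarrow> induced_path G c b T \<Longrightarrow> separated G S T c \<Longrightarrow> between G a c b"
  unfolding between_def by (intro exI conjI)

lemma between_on_path_from:
  assumes "induced_path G a w R" "x \<in> R" "y \<in> R"
  shows "between G a x y \<or> between G a y x"
proof -
  obtain R1 R2 where R: "R = R1 \<union> R2" "induced_path G a x R1" "induced_path G x w R2"
    "separated G R1 R2 x" by (rule induced_path_split[OF assms(1,2)])
  show ?thesis
  proof (cases "y \<in> R1")
    case True
    obtain T1 T2 where T: "R1 = T1 \<union> T2" "induced_path G a y T1" "induced_path G y x T2"
      "separated G T1 T2 y" by (rule induced_path_split[OF R(2) True])
    then show ?thesis using betweenI by blast
  next
    case False
    then have "y \<in> R2" using R(1) assms(3) by simp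
    moreover have "x \<in> R2" using induced_path_ends[OF R(3)] by simp
    ultimately obtain T where "T \<subseteq> R2" "induced_path G x y T"
      using induced_subpath[OF R(3)] by metis
    then show ?thesis using betweenI[OF R(2)] separated_mono[OF R(4)] by blast
  qed
qed

lemma between_on_two_sides:
  assumes "induced_path G u a S1" "induced_path G a v S2" "separated G S1 S2 a"
    and "x \<in> S1" "y \<in> S2"
  shows "between G x a y"
proof -
  have "a \<in> S1" "a \<in> S2" using assms induced_path_ends by metis+
  then obtain T1 T2 where "T1 \<subseteq> S1" "induced_path G x a T1" "T2 \<subseteq> S2" "induced_path G a y T2"
    using induced_subpath[OF assms(1,4)] induced_subpath[OF assms(2) _ assms(5)] by metis
  then show ?thesis using betweenI separated_mono[OF assms(3)] by blast
qed

text \<open>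
  Of three vertices on an induced path, one lies between the other two. Splitting the path at \<open>a\<close>
  leaves \<open>b\<close> and \<open>c\<close> either on different sides of \<open>a\<close> or on the same side.
\<close>

lemma collinear_imp_between:
  assumes "collinear G a b c"
  shows "between G b a c \<or> between G a b c \<or> between G a c b"
proof -
  obtain u v S where S: "induced_path G u v S" "a \<in> S" "b \<in> S" "c \<in> S"
    using assms unfolding collinear_def by blast
  obtain S1 S2 where S12: "S = S1 \<union> S2" "induced_path G u a S1" "induced_path G a v S2"
    "separated G S1 S2 a" by (rule induced_path_split[OF S(1,2)])
  consider "b \<in> S1" "c \<in> S1" | "b \<in> S1" "c \<in> S2" | "b \<in> S2" "c \<in> S1" | "b \<in> S2" "c \<in> S2"
    using S(3,4) S12(1) by auto
  then show ?thesis
  proof cases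
    case 1 then show ?thesis using between_on_path_from[OF induced_path_rev[OF S12(2)]] by blast
  next
    case 2 then show ?thesis using between_on_two_sides[OF S12(2-4)] by blast
  next
    case 3 then show ?thesis using between_on_two_sides[OF S12(2-4)] between_sym by blast
  next
    case 4 then show ?thesis using between_on_path_from[OF S12(3)] by blast
  qed
qed

lemma between_ends:
  assumes "between G a c b" "c \<noteq> a" "c \<noteq> b"
  obtains U where "induced_path G a b U" "c \<in> U" "a \<noteq> b" "(a, b) \<notin> parcs G"
proof -
  obtain S T where ST: "induced_path G a c S" "induced_path G c b T" "separated G S T c"
    using assms(1) unfolding between_def by blast
  have "a \<noteq> b" "(a, b) \<notin> parcs G"
    using ST(3) assms(2,3) induced_path_ends[OF ST(1)] induced_path_ends[OF ST(2)]
    unfolding separated_def by auto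
  then show ?thesis
    using that[OF induced_path_join[OF ST]] induced_path_ends[OF ST(1)] by simp
qed

lemma small_induced_path:
  assumes "induced_path G a b S" "card S \<le> 2" "a \<noteq> b"
  shows "(a, b) \<in> parcs G"
  using assms(1)
proof (cases rule: induced_path.cases)
  case single
  then show ?thesis using assms by simp
next
  case (step c T)
  have "finite T" by (rule induced_path_finite[OF step(3)])
  then have "card T \<le> 1" using step(1,5) assms(2) by simp
  moreover have "c \<in> T" "b \<in> T" using induced_path_ends[OF step(3)] by simp_all
  ultimately have "b = c" using \<open>finite T\<close> by (metis card_le_Suc0_iff_eq One_nat_def)
  then show ?thesis using step(2) by simp
qed

end

section \<open>Connected triangle-free graphs\<close>

lemma third_element:
  assumes "card K \<ge> 3"
  shows "\<exists>c\<in>K. c \<noteq> a \<and> c \<noteq> b"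
proof (rule ccontr)
  assume "\<not> ?thesis"
  then have "K \<subseteq> {a, b}" by blast
  then have "card K \<le> card {a, b}" by (intro card_mono) auto
  then show False using assms card_insert_le_m1[of 2 "{b}" a] by simp
qed

locale triangle_free_connected = pair_graph +
  assumes connected_G: "Digraph_Component.connected (with_proj G)"
    and no_triangle: "triangle_free G"
    and order_ge_3: "card (pverts G) \<ge> 3"
begin

lemma triangle: "(a, b) \<in> parcs G \<Longrightarrow> (b, c) \<in> parcs G \<Longrightarrow> (a, c) \<notin> parcs G"
  using no_triangle unfolding triangle_free_def by blast

lemma induced_path_exists:
  assumes "a \<in> pverts G" "b \<in> pverts G"
  obtains S where "induced_path G a b S"
proof -
  have "strongly_connected (with_proj G)"
    using symmetric_connected_imp_strongly_connected[OF pair_sym_arcs connected_G] .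
  then have "a \<rightarrow>\<^sup>*\<^bsub>with_proj G\<^esub> b" using assms by auto
  then have "\<exists>S. induced_path G a b S"
  proof (induction rule: converse_reachable_induct)
    case base
    then have "induced_path G b b {b}" by (simp add: induced_path.single)
    then show ?case by (rule exI)
  next
    case (step x y)
    then obtain T where T: "induced_path G y b T" by blast
    have xy: "(x, y) \<in> parcs G" using step by simp
    show ?case
    proof (cases "x \<in> T")
      case True
      then show ?thesis using induced_subpath[OF T] induced_path_ends[OF T] by metis
    next
      case False
      then show ?thesis
        using induced_path_prepend[OF T] xy induced_path_ends[OF T] in_arcsD1 by blast
    qed
  qed
  then show ?thesis using that by blast
qed

text \<open>
  The neighbour \<open>l\<close> provides the third layer that the detours in \<open>two_in_layer\<close> and
  \<open>same_layer\<close> pass through: an edge by itself leaves too little room for them.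
\<close>

lemma edge_extends:
  assumes "(u, v) \<in> parcs G"
  obtains l where "l \<noteq> u" "l \<noteq> v" "(u, l) \<in> parcs G \<or> (v, l) \<in> parcs G"
proof -
  obtain w where w: "w \<in> pverts G" "w \<notin> {u, v}"
    using third_element[OF order_ge_3, of u v] by blast
  \<comment> \<open>The vertex just before the path from \<open>w\<close> first meets \<open>{u, v}\<close> is the required neighbour.\<close>
  obtain S where S: "induced_path G w u S"
    using induced_path_exists w(1) assms in_arcsD1 by blast
  have "w \<notin> {u, v} \<Longrightarrow> u' = u \<Longrightarrow>
    \<exists>l. l \<noteq> u \<and> l \<noteq> v \<and> ((u, l) \<in> parcs G \<or> (v, l) \<in> parcs G)"
    if "induced_path G w u' S" for w u' S
    using that
  proof (induction rule: induced_path.induct)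
    case (step a c b T)
    show ?case
    proof (cases "c \<in> {u, v}")
      case True
      then show ?thesis using step.hyps(1) step.prems arcs_symmetric by blast
    qed (use step in blast)
  qed simp
  then show ?thesis using S w that by blast
qed

text \<open>
  An induced path from \<open>a\<close> to \<open>c\<close> that avoids \<open>b\<close> can be prolonged to \<open>b\<close> if \<open>b\<close> has no neighbour
  on it besides \<open>a\<close>. If \<open>b\<close> has another one, its shortcut to \<open>c\<close> misses the successor \<open>d\<close> of \<open>a\<close>,
  since \<open>a, b, d\<close> would form a triangle otherwise; then \<open>b\<close> is the only neighbour of \<open>a\<close> on the
  shortcut, which can be prolonged to \<open>a\<close> instead.
\<close>

lemma adjacent_imp_collinear:
  assumes ab: "(a, b) \<in> parcs G" and c: "c \<in> pverts G"
  shows "collinear G a b c"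
proof -
  obtain S where S: "induced_path G a c S"
    using induced_path_exists in_arcsD1 ab c by blast
  show ?thesis
  proof (cases "b \<in> S")
    case True
    then show ?thesis using S induced_path_ends[OF S] collinearI by metis
  next
    case b: False
    have bV: "b \<in> pverts G" and ba: "(b, a) \<in> parcs G" using ab in_arcsD2 arcs_symmetric by auto
    from S show ?thesis
    proof (cases rule: induced_path.cases)
      case single
      then show ?thesis
        using collinearI[OF induced_path_edge[OF ab]] by simp
    next
      case (step d T)
      show ?thesis
      proof (cases "\<exists>t\<in>T. (b, t) \<in> parcs G")
        case False
        have "induced_path G b c (insert b S)"
          using induced_path.step[OF ba S bV b] False step by auto
        moreover have "a \<in> S" "c \<in> S" using induced_path_ends[OF S] by auto
        ultimately show ?thesis by (meson collinearI insertI1 insertI2)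
      next
        case True
        have "(b, d) \<notin> parcs G" using triangle[OF ba] step by blast
        then obtain R where R: "R \<subseteq> insert b T" "induced_path G b c R" "d \<notin> R"
          using induced_path_prepend[OF step(3) bV _ True] step b by blast
        have "a \<notin> R" using R step ab no_loops' by blast
        then have "induced_path G a c (insert a R)"
          using induced_path.step[OF ab R(2) in_arcsD1[OF ab]] R step by auto
        moreover have "b \<in> R" "c \<in> R" using induced_path_ends[OF R(2)] by auto
        ultimately show ?thesis by (meson collinearI insertI1 insertI2)
      qed
    qed
  qed
qed

lemma noncollinear_nonadjacent:
  assumes "\<not> collinear G a b c" "a \<in> pverts G" "b \<in> pverts G" "c \<in> pverts G"
  shows "(a, b) \<notin> parcs G" "(b, c) \<notin> parcs G" "(a, c) \<notin> parcs G"
    "(b, a) \<notin> parcs G" "(c, b) \<notin> parcs G" "(c, a) \<notin> parcs G"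
proof -
  note adj = adjacent_imp_collinear
  show "(a, b) \<notin> parcs G" "(b, c) \<notin> parcs G" "(a, c) \<notin> parcs G"
    using adj[of a b c] adj[of b c a] adj[of a c b] assms collinear_swap12 collinear_swap23
    by metis+
  then show "(b, a) \<notin> parcs G" "(c, b) \<notin> parcs G" "(c, a) \<notin> parcs G"
    using arcs_symmetric by blast+
qed

text \<open>
  Take an induced path of least size between two elements \<open>a\<close>, \<open>b\<close> of \<open>K\<close>, and a further element
  \<open>c\<close> with a neighbour \<open>p\<close> on it. Replacing either half of the path by the edge from \<open>p\<close> to \<open>c\<close>
  and taking shortcuts gives an induced path between elements of \<open>K\<close> again, so by minimality each
  half is a single edge. Thus the path is \<open>a, p, b\<close>, and as elements of \<open>K\<close> are pairwise
  nonadjacent, every other element of \<open>K\<close> has to be adjacent to \<open>p\<close>.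
\<close>

lemma dominated_set_in_neighbourhood:
  assumes K: "K \<subseteq> pverts G" and ge3: "card K \<ge> 3"
    and nonadj: "\<And>a b. a \<in> K \<Longrightarrow> b \<in> K \<Longrightarrow> (a, b) \<notin> parcs G"
    and dom: "\<And>a b c S. \<lbrakk>a \<in> K; b \<in> K; c \<in> K; a \<noteq> b; c \<noteq> a; c \<noteq> b; induced_path G a b S\<rbrakk>
      \<Longrightarrow> c \<notin> S \<and> (\<exists>p\<in>S. (c, p) \<in> parcs G)"
  obtains p where "p \<in> pverts G" "K \<subseteq> nbhd G p"
proof -
  define P where "P = (\<lambda>(a, b, S). a \<in> K \<and> b \<in> K \<and> a \<noteq> b \<and> induced_path G a b S)"
  note third = third_element[OF ge3]
  obtain a0 b0 where "a0 \<in> K" "b0 \<in> K" "a0 \<noteq> b0" using third by metis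
  moreover then obtain S0 where "induced_path G a0 b0 S0"
    using induced_path_exists K by blast
  ultimately have "P (a0, b0, S0)" by (simp add: P_def)
  then obtain x where x: "P x" "\<And>y. P y \<Longrightarrow> card (snd (snd x)) \<le> card (snd (snd y))"
    using ex_has_least_nat[of P _ "\<lambda>x. card (snd (snd x))"] by blast
  obtain a b S where x_eq: "x = (a, b, S)" by (cases x)
  have S: "a \<in> K" "b \<in> K" "a \<noteq> b" "induced_path G a b S" using x by (auto simp: P_def x_eq)
  have least: "card S \<le> card T" if "a' \<in> K" "b' \<in> K" "a' \<noteq> b'" "induced_path G a' b' T" for a' b' T
    using x(2)[of "(a', b', T)"] that by (simp add: P_def x_eq)
  obtain c where c: "c \<in> K" "c \<noteq> a" "c \<noteq> b" using third by metis
  obtain p where p: "c \<notin> S" "p \<in> S" "(c, p) \<in> parcs G" using dom[OF S(1,2) c(1) S(3) c(2,3) S(4)] by blast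
  have pab: "p \<noteq> a" "p \<noteq> b" using p nonadj c S by auto
  obtain S1 S2 where S12: "S = S1 \<union> S2" "induced_path G a p S1" "induced_path G p b S2" "separated G S1 S2 p"
    by (rule induced_path_split[OF S(4) p(2)])
  have fin: "finite S1" "finite S2" using S12 induced_path_finite by metis+
  have "S1 \<inter> S2 = {p}"
    using S12(4) induced_path_ends[OF S12(2)] induced_path_ends[OF S12(3)]
    unfolding separated_def by blast
  then have cardS: "card S + 1 = card S1 + card S2"
    using card_Un_Int[OF fin] S12(1) by simp
  have short: "card T \<le> 2" if sh: "induced_path G p e R" "induced_path G p f T" "e \<in> K" "e \<noteq> c"
    "R \<subseteq> S" "card S + 1 = card R + card T" for e f R T
  proof -
    have pR: "p \<in> R" using induced_path_ends sh(1) by metis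
    have cV: "c \<in> pverts G" using c K by blast
    obtain Q where Q: "Q \<subseteq> insert c R" "induced_path G c e Q"
      using induced_path_prepend[OF sh(1) cV] p sh(5) pR by blast
    have "finite R" by (rule induced_path_finite[OF sh(1)])
    have "card S \<le> card Q" using least[OF c(1) sh(3) _ Q(2)] sh(4) by blast
    also have "\<dots> \<le> card (insert c R)" using Q \<open>finite R\<close> by (intro card_mono) auto
    also have "\<dots> \<le> card R + 1" using \<open>finite R\<close> by (simp add: card_insert_if)
    finally show ?thesis using sh(6) by simp
  qed
  have "card S1 \<le> 2"
    using short[OF S12(3) induced_path_rev[OF S12(2)] S(2) c(3)[symmetric]] cardS S12(1) by simp
  then have ap: "(a, p) \<in> parcs G" using small_induced_path[OF S12(2)] pab by blast
  have "card S2 \<le> 2"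
    using short[OF induced_path_rev[OF S12(2)] S12(3) S(1) c(2)[symmetric]] cardS S12(1) by simp
  then have pb: "(p, b) \<in> parcs G" using small_induced_path[OF S12(3)] pab by blast
  have apb: "induced_path G a b {a, p, b}"
    using induced_path.step[OF ap induced_path_edge[OF pb] in_arcsD1[OF ap]] pab S(1-3) nonadj
    by blast
  have "(p, d) \<in> parcs G" if d: "d \<in> K" for d
  proof (cases "d = a \<or> d = b")
    case True
    then show ?thesis using ap pb arcs_symmetric by blast
  next
    case False
    then obtain q where "q \<in> {a, p, b}" "(d, q) \<in> parcs G"
      using dom[OF S(1,2) d S(3) _ _ apb] by blast
    then show ?thesis using nonadj[OF d] S(1,2) arcs_symmetric by blast
  qed
  then show ?thesis using that[of p] ap in_arcsD2 by (auto simp: nbhd_def)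
qed

text \<open>
  Without triangles a simplicial vertex has at most one neighbour. Either alternative provides a
  path on three vertices with \<open>g\<close> on it, at the end or in the middle.
\<close>

lemma simplicial_or_two_neighbours:
  assumes "g \<in> pverts G"
  shows "simplicial G g \<and> (\<exists>g1 g2. (g, g1) \<in> parcs G \<and> (g1, g2) \<in> parcs G \<and> g2 \<noteq> g) \<or>
    (\<exists>g1 g2. (g, g1) \<in> parcs G \<and> (g, g2) \<in> parcs G \<and> g1 \<noteq> g2)"
proof (cases "\<exists>g1 g2. (g, g1) \<in> parcs G \<and> (g, g2) \<in> parcs G \<and> g1 \<noteq> g2")
  case False
  then have s: "simplicial G g" using assms by (auto simp: simplicial_def nbhd_def)
  have "pverts G \<noteq> {g}" using order_ge_3 by auto
  then obtain w where w: "w \<in> pverts G" "w \<noteq> g" using assms by blast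
  obtain S where "induced_path G g w S" using induced_path_exists w assms by blast
  then obtain g1 where g1: "(g, g1) \<in> parcs G" using w by (cases rule: induced_path.cases) auto
  obtain l where "l \<noteq> g" "l \<noteq> g1" "(g, l) \<in> parcs G \<or> (g1, l) \<in> parcs G"
    using edge_extends[OF g1] by blast
  then show ?thesis using False s g1 by blast
qed blast

end

section \<open>Induced paths in the Cartesian product\<close>

lemma cartesian_product_verts [simp]:
  "pverts (cartesian_product G H) = pverts G \<times> pverts H"
  by (simp add: cartesian_product_def)

lemma cartesian_product_adj:
  "((g, h), (g', h')) \<in> parcs (cartesian_product G H) \<longleftrightarrow>
     (g, g') \<in> parcs G \<and> h \<in> pverts H \<and> h = h' \<or> g \<in> pverts G \<and> g = g' \<and> (h, h') \<in> parcs H"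
  by (simp add: cartesian_product_def)

lemma induced_path_swap:
  assumes "induced_path (cartesian_product G H) a b S"
  shows "induced_path (cartesian_product H G) (prod.swap a) (prod.swap b) (prod.swap ` S)"
  using assms
proof (induction rule: induced_path.induct)
  case (single v)
  then show ?case using induced_path.single[of "prod.swap v" "cartesian_product H G"]
    by (cases v) simp
next
  case (step a c b T)
  have adj: "(prod.swap x, prod.swap y) \<in> parcs (cartesian_product H G) \<longleftrightarrow>
      (x, y) \<in> parcs (cartesian_product G H)" for x y
    by (cases x; cases y) (auto simp: cartesian_product_adj)
  have "induced_path (cartesian_product H G) (prod.swap a) (prod.swap b)
      (insert (prod.swap a) (prod.swap ` T))"
  proof (rule induced_path.step[OF _ step.IH])
    show "\<forall>t\<in>prod.swap ` T - {prod.swap c}. (prod.swap a, t) \<notin> parcs (cartesian_product H G)"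
    proof
      fix t assume "t \<in> prod.swap ` T - {prod.swap c}"
      then obtain x where "t = prod.swap x" "x \<in> T - {c}" by blast
      then show "(prod.swap a, t) \<notin> parcs (cartesian_product H G)"
        using step.hyps(5) by (simp add: adj)
    qed
    show "prod.swap a \<notin> prod.swap ` T" using step.hyps(4) by (simp add: inj_image_mem_iff)
    show "prod.swap a \<in> pverts (cartesian_product H G)" using step.hyps(3) by (cases a) simp
  qed (simp add: adj step.hyps(1))
  then show ?case by simp
qed

lemma collinear_swap:
  assumes "collinear (cartesian_product G H) (g1, h1) (g2, h2) (g3, h3)"
  shows "collinear (cartesian_product H G) (h1, g1) (h2, g2) (h3, g3)"
proof -
  obtain u v S where S: "induced_path (cartesian_product G H) u v S"
    "{(g1, h1), (g2, h2), (g3, h3)} \<subseteq> S"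
    using assms unfolding collinear_def by blast
  have "{(h1, g1), (h2, g2), (h3, g3)} \<subseteq> prod.swap ` S" using S(2) by force
  then show ?thesis using induced_path_swap[OF S(1)] unfolding collinear_def by blast
qed

locale two_graphs = G: triangle_free_connected G + H: triangle_free_connected H
  for G :: "'a pair_pre_digraph" and H :: "'b pair_pre_digraph"
begin

abbreviation X :: "('a \<times> 'b) pair_pre_digraph" where "X \<equiv> cartesian_product G H"

lemma product_graph: "pair_graph X"
  by (rule pair_graph_cartesian_product[OF G.pair_graph H.pair_graph])

lemma swapped: "two_graphs H G"
  by unfold_locales

lemmas join = pair_graph.induced_path_join[OF product_graph]

lemma layer_G:
  assumes "induced_path G a b S" "h \<in> pverts H"
  shows "induced_path X (a, h) (b, h) (S \<times> {h})"
  using assms(1)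
proof (induction rule: induced_path.induct)
  case (single v)
  then show ?case using induced_path.single[of "(v, h)" X] assms(2) by simp
next
  case (step a c b T)
  have "induced_path X (a, h) (b, h) (insert (a, h) (T \<times> {h}))"
  proof (rule induced_path.step[OF _ step.IH])
    show "\<forall>t\<in>T \<times> {h} - {(c, h)}. ((a, h), t) \<notin> parcs X"
      using step.hyps(4,5) by (auto simp: cartesian_product_adj)
  qed (use step.hyps(1,3,4) assms(2) in \<open>simp_all add: cartesian_product_adj\<close>)
  then show ?case by (simp add: insert_Times_insert)
qed

lemma layer_H:
  assumes "induced_path H a b S" "g \<in> pverts G"
  shows "induced_path X (g, a) (g, b) ({g} \<times> S)"
proof -
  interpret s: two_graphs H G by (rule swapped)
  have "prod.swap ` (S \<times> {g}) = {g} \<times> S" by auto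
  then show ?thesis using induced_path_swap[OF s.layer_G[OF assms]] by simp
qed

lemma corner:
  assumes "g \<in> pverts G" "k \<in> pverts G" "h \<in> pverts H" "h' \<in> pverts H"
  shows "collinear X (k, h) (g, h) (g, h')"
proof -
  obtain P where P: "induced_path G k g P" by (rule G.induced_path_exists[OF assms(2,1)])
  obtain Q where Q: "induced_path H h h' Q" by (rule H.induced_path_exists[OF assms(3,4)])
  have "separated X (P \<times> {h}) ({g} \<times> Q) (g, h)"
    by (auto simp: separated_def cartesian_product_adj)
  then show ?thesis
    using collinearI[OF join[OF layer_G[OF P assms(3)] layer_H[OF Q assms(1)]]]
      induced_path_ends[OF P] induced_path_ends[OF Q] by simp
qed

text \<open>
  Walk from \<open>(a, p)\<close> within the layer of \<open>a\<close> to height \<open>q\<close>, follow \<open>U\<close> at that height to \<open>b\<close>, and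
  walk within the layer of \<open>b\<close> to height \<open>r\<close>. The two arms do not interfere, whatever their
  shapes are, because \<open>a\<close> and \<open>b\<close> are nonadjacent.
\<close>

lemma bracket:
  assumes U: "induced_path G a b U" "c \<in> U" and ab: "a \<noteq> b" "(a, b) \<notin> parcs G"
    and V: "p \<in> pverts H" "q \<in> pverts H" "r \<in> pverts H"
  shows "collinear X (a, p) (c, q) (b, r)"
proof -
  obtain Q where Q: "induced_path H p q Q" by (rule H.induced_path_exists[OF V(1,2)])
  obtain R where R: "induced_path H q r R" by (rule H.induced_path_exists[OF V(2,3)])
  have abV: "a \<in> pverts G" "b \<in> pverts G"
    using induced_path_ends[OF U(1)] induced_path_subset[OF U(1)] by auto
  have "separated X ({a} \<times> Q) (U \<times> {q}) (a, q)"
    by (auto simp: separated_def cartesian_product_adj)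
  note 1 = join[OF layer_H[OF Q abV(1)] layer_G[OF U(1) V(2)] this]
  have "separated X ({a} \<times> Q \<union> U \<times> {q}) ({b} \<times> R) (b, q)"
    using ab by (auto simp: separated_def cartesian_product_adj)
  note 2 = join[OF 1 layer_H[OF R abV(2)] this]
  show ?thesis
    using collinearI[OF 2] induced_path_ends[OF Q] induced_path_ends[OF R] U(2) by simp
qed

text \<open>
  The vertex between the other two in \<open>G\<close> becomes the point on the back of a bracket, so its
  second coordinate is the height at which the bracket crosses \<open>G\<close>.
\<close>

lemma collinear_lift_G:
  assumes col: "collinear G a b c" and abc: "a \<noteq> b" "b \<noteq> c" "a \<noteq> c"
    and V: "p \<in> pverts H" "q \<in> pverts H" "r \<in> pverts H"
  shows "collinear X (a, p) (b, q) (c, r)"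
proof -
  have mid: "collinear X (x, p') (y, q') (z, r')"
    if xyz: "between G x y z" "y \<noteq> x" "y \<noteq> z" "p' \<in> pverts H" "q' \<in> pverts H" "r' \<in> pverts H"
    for x y z p' q' r'
  proof -
    obtain U where U: "induced_path G x z U" "y \<in> U" "x \<noteq> z" "(x, z) \<notin> parcs G"
      by (rule G.between_ends[OF xyz(1-3)])
    show ?thesis by (rule bracket[OF U xyz(4-6)])
  qed
  consider "between G b a c" | "between G a b c" | "between G a c b"
    using G.collinear_imp_between[OF col] by blast
  then show ?thesis
  proof cases
    case 1
    then have "collinear X (b, q) (a, p) (c, r)" using mid abc V by metis
    then show ?thesis by (rule collinear_swap12)
  next
    case 2
    then show ?thesis using mid abc V by metis
  next
    case 3
    then have "collinear X (a, p) (c, r) (b, q)" using mid abc V by metis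
    then show ?thesis by (rule collinear_swap23)
  qed
qed

lemma collinear_lift_H:
  assumes "collinear H p q r" "p \<noteq> q" "q \<noteq> r" "p \<noteq> r"
    and "a \<in> pverts G" "b \<in> pverts G" "c \<in> pverts G"
  shows "collinear X (a, p) (b, q) (c, r)"
  using collinear_swap[OF two_graphs.collinear_lift_G[OF swapped assms]] .

text \<open>
  If neither projection is collinear, walk through the three points by alternating steps in \<open>H\<close> and
  \<open>G\<close>. Two nonconsecutive segments could touch only if two projections were adjacent or if
  the path between two projections met the third one.
\<close>

lemma distinct_coordinates:
  assumes G: "g1 \<noteq> g2" "g2 \<noteq> g3" "g1 \<noteq> g3" "g1 \<in> pverts G" "g2 \<in> pverts G" "g3 \<in> pverts G"
    and H: "h1 \<noteq> h2" "h2 \<noteq> h3" "h1 \<noteq> h3" "h1 \<in> pverts H" "h2 \<in> pverts H" "h3 \<in> pverts H"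
  shows "collinear X (g1, h1) (g2, h2) (g3, h3)"
proof (cases "collinear G g1 g2 g3 \<or> collinear H h1 h2 h3")
  case True
  then show ?thesis using collinear_lift_G collinear_lift_H G H by metis
next
  case False
  then have nG: "\<not> collinear G g1 g2 g3" and nH: "\<not> collinear H h1 h2 h3" by auto
  note adjG = G.noncollinear_nonadjacent[OF nG G(4-6)]
  note adjH = H.noncollinear_nonadjacent[OF nH H(4-6)]
  obtain P1 where P1: "induced_path G g1 g2 P1" by (rule G.induced_path_exists[OF G(4,5)])
  obtain P2 where P2: "induced_path G g2 g3 P2" by (rule G.induced_path_exists[OF G(5,6)])
  obtain Q1 where Q1: "induced_path H h1 h2 Q1" by (rule H.induced_path_exists[OF H(4,5)])
  obtain Q2 where Q2: "induced_path H h2 h3 Q2" by (rule H.induced_path_exists[OF H(5,6)])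
  note ends = induced_path_ends[OF P1] induced_path_ends[OF P2]
    induced_path_ends[OF Q1] induced_path_ends[OF Q2]
  have off: "g3 \<notin> P1" "g1 \<notin> P2" "h3 \<notin> Q1" "h1 \<notin> Q2"
    using collinearI[OF P1, of g1 g2 g3] collinearI[OF P2, of g1 g2 g3]
      collinearI[OF Q1, of h1 h2 h3] collinearI[OF Q2, of h1 h2 h3] ends nG nH by blast+
  have "separated X ({g1} \<times> Q1) (P1 \<times> {h2}) (g1, h2)"
    by (auto simp: separated_def cartesian_product_adj)
  note 1 = join[OF layer_H[OF Q1 G(4)] layer_G[OF P1 H(5)] this]
  have "separated X ({g1} \<times> Q1 \<union> P1 \<times> {h2}) ({g2} \<times> Q2) (g2, h2)"
    using adjG G by (auto simp: separated_def cartesian_product_adj)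
  note 2 = join[OF 1 layer_H[OF Q2 G(5)] this]
  have "separated X ({g1} \<times> Q1 \<union> P1 \<times> {h2} \<union> {g2} \<times> Q2) (P2 \<times> {h3}) (g2, h3)"
    using adjG adjH G H off by (auto simp: separated_def cartesian_product_adj)
  note 3 = join[OF 2 layer_G[OF P2 H(6)] this]
  show ?thesis using collinearI[OF 3] ends by simp
qed

text \<open>
  If \<open>g\<close> and \<open>k\<close> are nonadjacent, a bracket with back from \<open>g\<close> to \<open>k\<close> at height \<open>h2\<close> works.
  For an edge \<open>g k\<close> and noncollinear heights, a third layer \<open>l\<close> beside the edge is used. If \<open>l\<close> is a
  neighbour of \<open>k\<close>, walk from \<open>h1\<close> to \<open>h2\<close> over \<open>g\<close>, cross \<open>k\<close> at height \<open>h2\<close>, walk to \<open>h3\<close> over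
  \<open>l\<close>, and step back to \<open>(k, h3)\<close>. If \<open>l\<close> is a neighbour of \<open>g\<close>, walk from \<open>h3\<close> to \<open>h1\<close> over \<open>k\<close>,
  cross \<open>g\<close> at height \<open>h1\<close>, walk to \<open>h2\<close> over \<open>l\<close>, and step back to \<open>(g, h2)\<close>.
\<close>

lemma two_in_layer:
  assumes G: "g \<noteq> k" "g \<in> pverts G" "k \<in> pverts G"
    and H: "h1 \<noteq> h2" "h2 \<noteq> h3" "h1 \<noteq> h3" "h1 \<in> pverts H" "h2 \<in> pverts H" "h3 \<in> pverts H"
  shows "collinear X (g, h1) (g, h2) (k, h3)"
proof (cases "(g, k) \<in> parcs G")
  case False
  obtain U where U: "induced_path G g k U" by (rule G.induced_path_exists[OF G(2,3)])
  show ?thesis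
    using bracket[OF U _ G(1) False H(4-6)] induced_path_ends[OF U] by blast
next
  case gk: True
  show ?thesis
  proof (cases "collinear H h1 h2 h3")
    case True
    then show ?thesis using collinear_lift_H H G by metis
  next
    case nH: False
    note adjH = H.noncollinear_nonadjacent[OF nH H(4-6)]
    obtain Q where Q: "induced_path H h1 h2 Q" by (rule H.induced_path_exists[OF H(4,5)])
    note Qends = induced_path_ends[OF Q]
    have h3: "h3 \<notin> Q" using collinearI[OF Q, of h1 h2 h3] Qends nH by blast
    obtain l where l: "l \<noteq> g" "l \<noteq> k" "(g, l) \<in> parcs G \<or> (k, l) \<in> parcs G"
      by (rule G.edge_extends[OF gk])
    then consider "(k, l) \<in> parcs G" | "(g, l) \<in> parcs G" by blast
    then show ?thesis
    proof cases
      case kl: 1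
      have gl: "(g, l) \<notin> parcs G" using G.triangle[OF gk kl] .
      obtain R where R: "induced_path H h2 h3 R" by (rule H.induced_path_exists[OF H(5,6)])
      have lV: "l \<in> pverts G" using kl G.in_arcsD2 by blast
      have lk: "(l, k) \<in> parcs G" using kl G.arcs_symmetric by blast
      have "separated X ({g} \<times> Q) ({g, k} \<times> {h2}) (g, h2)"
        by (auto simp: separated_def cartesian_product_adj)
      note 1 = join[OF layer_H[OF Q G(2)] layer_G[OF G.induced_path_edge[OF gk] H(5)] this]
      have "separated X ({g} \<times> Q \<union> {g, k} \<times> {h2}) ({k, l} \<times> {h2}) (k, h2)"
        using gl l G by (auto simp: separated_def cartesian_product_adj dest: H.no_loops')
      note 2 = join[OF 1 layer_G[OF G.induced_path_edge[OF kl] H(5)] this]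
      have "separated X ({g} \<times> Q \<union> {g, k} \<times> {h2} \<union> {k, l} \<times> {h2}) ({l} \<times> R) (l, h2)"
        using gl l G by (auto simp: separated_def cartesian_product_adj)
      note 3 = join[OF 2 layer_H[OF R lV] this]
      have "separated X ({g} \<times> Q \<union> {g, k} \<times> {h2} \<union> {k, l} \<times> {h2} \<union> {l} \<times> R)
          ({l, k} \<times> {h3}) (l, h3)"
        using gl l G H adjH h3 by (auto simp: separated_def cartesian_product_adj)
      note 4 = join[OF 3 layer_G[OF G.induced_path_edge[OF lk] H(6)] this]
      show ?thesis using collinearI[OF 4] Qends by simp
    next
      case gl: 2
      have kg: "(k, g) \<in> parcs G" using gk G.arcs_symmetric by blast
      have kl: "(k, l) \<notin> parcs G" using G.triangle[OF kg gl] .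
      have lg: "(l, g) \<in> parcs G" using gl G.arcs_symmetric by blast
      have lV: "l \<in> pverts G" using gl G.in_arcsD2 by blast
      obtain R where R: "induced_path H h3 h1 R" by (rule H.induced_path_exists[OF H(6,4)])
      note Rends = induced_path_ends[OF R]
      have h2: "h2 \<notin> R" using collinearI[OF R, of h1 h2 h3] Rends nH by blast
      have "separated X ({k} \<times> R) ({k, g} \<times> {h1}) (k, h1)"
        by (auto simp: separated_def cartesian_product_adj)
      note 1 = join[OF layer_H[OF R G(3)] layer_G[OF G.induced_path_edge[OF kg] H(4)] this]
      have "separated X ({k} \<times> R \<union> {k, g} \<times> {h1}) ({g, l} \<times> {h1}) (g, h1)"
        using kl l G by (auto simp: separated_def cartesian_product_adj dest: H.no_loops')
      note 2 = join[OF 1 layer_G[OF G.induced_path_edge[OF gl] H(4)] this]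
      have "separated X ({k} \<times> R \<union> {k, g} \<times> {h1} \<union> {g, l} \<times> {h1}) ({l} \<times> Q) (l, h1)"
        using kl l G by (auto simp: separated_def cartesian_product_adj)
      note 3 = join[OF 2 layer_H[OF Q lV] this]
      have "separated X ({k} \<times> R \<union> {k, g} \<times> {h1} \<union> {g, l} \<times> {h1} \<union> {l} \<times> Q)
          ({l, g} \<times> {h2}) (l, h2)"
        using kl l G H adjH h2 by (auto simp: separated_def cartesian_product_adj)
      note 4 = join[OF 3 layer_G[OF G.induced_path_edge[OF lg] H(5)] this]
      show ?thesis using collinearI[OF 4] Rends by simp
    qed
  qed
qed

text \<open>
  If \<open>g\<close> had neighbours \<open>g1 \<noteq> g2\<close>, one could walk from \<open>h1\<close> to \<open>h2\<close> over \<open>g1\<close>, touch the layer of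
  \<open>g\<close> at \<open>h2\<close>, and walk on to \<open>h3\<close> over \<open>g2\<close>. So \<open>g\<close> is a leaf that starts a path \<open>g, g1, g2\<close>.
  Walking along \<open>S\<close> over \<open>g\<close>, then from \<open>h2\<close> to \<open>h3\<close> over \<open>g2\<close>, and finally back to \<open>(g, h3)\<close>,
  gives an induced path as long as \<open>h3\<close> has no neighbour on \<open>S\<close>.
\<close>

lemma same_layer:
  assumes g: "g \<in> pverts G"
    and H: "h1 \<noteq> h2" "h2 \<noteq> h3" "h1 \<noteq> h3" "h1 \<in> pverts H" "h2 \<in> pverts H" "h3 \<in> pverts H"
    and nX: "\<not> collinear X (g, h1) (g, h2) (g, h3)"
  shows "simplicial G g" "(h1, h2) \<notin> parcs H"
    "induced_path H h1 h2 S \<Longrightarrow> h3 \<notin> S \<and> (\<exists>p\<in>S. (h3, p) \<in> parcs H)"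
proof -
  have nH: "\<not> collinear H h1 h2 h3"
    using collinear_lift_H[OF _ H(1-3) g g g] nX by blast
  note adjH = H.noncollinear_nonadjacent[OF nH H(4-6)]
  show "(h1, h2) \<notin> parcs H" by (rule adjH)
  have off12: "h3 \<notin> P" if P: "induced_path H h1 h2 P" for P
    using collinearI[OF P, of h1 h2 h3] induced_path_ends[OF P] nH by blast
  obtain Q where Q: "induced_path H h2 h3 Q" by (rule H.induced_path_exists[OF H(5,6)])
  have off23: "h1 \<notin> Q"
    using collinearI[OF Q, of h1 h2 h3] induced_path_ends[OF Q] nH by blast
  have one_neighbour: "g1 = g2" if g1: "(g, g1) \<in> parcs G" and g2: "(g, g2) \<in> parcs G" for g1 g2
  proof (rule ccontr)
    assume ne: "g1 \<noteq> g2"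
    \<comment> \<open>The path visits \<open>(g, h1)\<close>, \<open>(g1, h1)\<close>, \<open>(g1, h2)\<close>, \<open>(g, h2)\<close>, \<open>(g2, h2)\<close>, \<open>(g2, h3)\<close>, \<open>(g, h3)\<close>.\<close>
    obtain P where P: "induced_path H h1 h2 P" by (rule H.induced_path_exists[OF H(4,5)])
    note off = off12[OF P] off23
    have r1: "(g1, g) \<in> parcs G" and r2: "(g2, g) \<in> parcs G"
      using g1 g2 G.arcs_symmetric by blast+
    have n12: "(g1, g2) \<notin> parcs G" using G.triangle[OF g1] g2 by blast
    have loops: "g1 \<noteq> g" "g2 \<noteq> g" using g1 g2 G.no_loops' by blast+
    have V: "g1 \<in> pverts G" "g2 \<in> pverts G" using g1 g2 G.in_arcsD2 by blast+
    have "separated X ({g, g1} \<times> {h1}) ({g1} \<times> P) (g1, h1)"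
      by (auto simp: separated_def cartesian_product_adj)
    note 1 = join[OF layer_G[OF G.induced_path_edge[OF g1] H(4)] layer_H[OF P V(1)] this]
    have "separated X ({g, g1} \<times> {h1} \<union> {g1} \<times> P) ({g1, g} \<times> {h2}) (g1, h2)"
      using H adjH loops by (auto simp: separated_def cartesian_product_adj)
    note 2 = join[OF 1 layer_G[OF G.induced_path_edge[OF r1] H(5)] this]
    have "separated X ({g, g1} \<times> {h1} \<union> {g1} \<times> P \<union> {g1, g} \<times> {h2}) ({g, g2} \<times> {h2}) (g, h2)"
      using H adjH loops ne n12 by (auto simp: separated_def cartesian_product_adj)
    note 3 = join[OF 2 layer_G[OF G.induced_path_edge[OF g2] H(5)] this]
    have "separated X ({g, g1} \<times> {h1} \<union> {g1} \<times> P \<union> {g1, g} \<times> {h2} \<union> {g, g2} \<times> {h2})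
        ({g2} \<times> Q) (g2, h2)"
      using H adjH loops ne n12 off by (auto simp: separated_def cartesian_product_adj)
    note 4 = join[OF 3 layer_H[OF Q V(2)] this]
    have "separated X ({g, g1} \<times> {h1} \<union> {g1} \<times> P \<union> {g1, g} \<times> {h2} \<union> {g, g2} \<times> {h2} \<union> {g2} \<times> Q)
        ({g2, g} \<times> {h3}) (g2, h3)"
      using H adjH loops ne n12 off by (auto simp: separated_def cartesian_product_adj)
    note 5 = join[OF 4 layer_G[OF G.induced_path_edge[OF r2] H(6)] this]
    show False using collinearI[OF 5, of "(g, h1)" "(g, h2)" "(g, h3)"] nX by simp
  qed
  then obtain g1 g2 where g12: "simplicial G g" "(g, g1) \<in> parcs G" "(g1, g2) \<in> parcs G" "g2 \<noteq> g"
    using G.simplicial_or_two_neighbours[OF g] by blast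
  show "simplicial G g" by (rule g12)
  assume S: "induced_path H h1 h2 S"
  have "\<exists>p\<in>S. (h3, p) \<in> parcs H"
  proof (rule ccontr)
    assume "\<not> ?thesis"
    then have far: "(h3, p) \<notin> parcs H" "(p, h3) \<notin> parcs H" if "p \<in> S" for p
      using that H.arcs_symmetric by blast+
    note off = off12[OF S] off23
    have n: "(g, g2) \<notin> parcs G" "(g2, g) \<notin> parcs G"
      using G.triangle[OF g12(2,3)] G.arcs_symmetric by blast+
    have V: "g1 \<in> pverts G" "g2 \<in> pverts G" using g12 G.in_arcsD2 by blast+
    have ne: "g1 \<noteq> g" "g1 \<noteq> g2" using g12 G.no_loops' by blast+
    have up: "induced_path G g g2 {g, g1, g2}"
      using induced_path.step[OF g12(2) G.induced_path_edge[OF g12(3)] g] g12(4) ne n by blast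
    have down: "induced_path G g2 g {g, g1, g2}" by (rule G.induced_path_rev[OF up])
    have "separated X ({g} \<times> S) ({g, g1, g2} \<times> {h2}) (g, h2)"
      by (auto simp: separated_def cartesian_product_adj)
    note 1 = join[OF layer_H[OF S g] layer_G[OF up H(5)] this]
    have "separated X ({g} \<times> S \<union> {g, g1, g2} \<times> {h2}) ({g2} \<times> Q) (g2, h2)"
      using g12(4) n by (auto simp: separated_def cartesian_product_adj)
    note 2 = join[OF 1 layer_H[OF Q V(2)] this]
    have "separated X ({g} \<times> S \<union> {g, g1, g2} \<times> {h2} \<union> {g2} \<times> Q) ({g, g1, g2} \<times> {h3}) (g2, h3)"
      using g12(4) n ne H adjH off far by (auto simp: separated_def cartesian_product_adj)
    note 3 = join[OF 2 layer_G[OF down H(6)] this]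
    show False
      using collinearI[OF 3, of "(g, h1)" "(g, h2)" "(g, h3)"] induced_path_ends[OF S] nX by simp
  qed
  then show "h3 \<notin> S \<and> (\<exists>p\<in>S. (h3, p) \<in> parcs H)" using off12[OF S] by blast
qed

section \<open>Sets without collinear triples in the product\<close>

lemma common_G_coordinate:
  assumes V: "x \<in> pverts X" "y \<in> pverts X" "z \<in> pverts X"
    and ne: "x \<noteq> y" "y \<noteq> z" "x \<noteq> z" and nX: "\<not> collinear X x y z" and xy: "fst x = fst y"
  shows "fst z = fst x"
proof (rule ccontr)
  assume z: "fst z \<noteq> fst x"
  obtain g h1 h2 k h3 where xyz: "x = (g, h1)" "y = (g, h2)" "z = (k, h3)"
    using xy by (cases x; cases y; cases z) auto
  have gk: "g \<noteq> k" "h1 \<noteq> h2" using z ne xyz by auto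
  have V': "g \<in> pverts G" "k \<in> pverts G" "h1 \<in> pverts H" "h2 \<in> pverts H" "h3 \<in> pverts H"
    using V xyz by auto
  consider "h3 = h1" | "h3 = h2" | "h3 \<noteq> h1" "h3 \<noteq> h2" by blast
  then have "collinear X x y z"
  proof cases
    case 1
    have "collinear X z x y" unfolding xyz 1 by (rule corner) (use V' in auto)
    then show ?thesis using collinear_swap12 collinear_swap23 by metis
  next
    case 2
    have "collinear X z y x" unfolding xyz 2 by (rule corner) (use V' in auto)
    then show ?thesis using collinear_swap12 collinear_swap23 by metis
  next
    case 3
    show ?thesis unfolding xyz by (rule two_in_layer) (use V' gk 3 in auto)
  qed
  then show False using nX by blast
qed

text \<open>
  Two elements of \<open>M\<close> in the layer of \<open>g\<close> force all of \<open>M\<close> into it. Their \<open>H\<close>-coordinates then form a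
  dominated set in the sense of \<open>dominated_set_in_neighbourhood\<close>.
\<close>

lemma card_le_max_degree:
  assumes M: "M \<subseteq> pverts X" "card M \<ge> 3"
    and noncol: "\<And>x y z. \<lbrakk>x \<in> M; y \<in> M; z \<in> M; x \<noteq> y; y \<noteq> z; x \<noteq> z\<rbrakk> \<Longrightarrow> \<not> collinear X x y z"
    and two: "(g, h) \<in> M" "(g, h') \<in> M" "h \<noteq> h'"
  shows "card M \<le> simplicial_indicator G * max_degree H"
proof -
  define K where "K = snd ` M"
  have "fst z = g" if "z \<in> M" for z
  proof (cases "z = (g, h) \<or> z = (g, h')")
    case False
    then have "fst z = fst (g, h)"
      using common_G_coordinate[of "(g, h)" "(g, h')" z] noncol[of "(g, h)" "(g, h')" z] that two M(1)
      by auto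
    then show ?thesis by simp
  qed auto
  then have M_eq: "M = {g} \<times> K" unfolding K_def by force
  then have cardK: "card M = card K" by (simp add: card_cartesian_product_singleton)
  have g: "g \<in> pverts G" using two M(1) by auto
  have K: "K \<subseteq> pverts H" using M(1) by (auto simp: K_def)
  have nc: "\<not> collinear X (g, a) (g, b) (g, c)"
    if "a \<in> K" "b \<in> K" "c \<in> K" "a \<noteq> b" "b \<noteq> c" "a \<noteq> c" for a b c
    using noncol[of "(g, a)" "(g, b)" "(g, c)"] that M_eq by simp
  have ge3: "card K \<ge> 3" using M(2) cardK by simp
  note third = third_element[OF ge3]
  have hK: "h \<in> K" "h' \<in> K" using two by (force simp: K_def)+
  obtain c where c: "c \<in> K" "c \<noteq> h" "c \<noteq> h'" using third by metis
  have leaf: "simplicial G g"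
    using same_layer(1)[OF g, of h h' c] nc[OF hK c(1) two(3)] K hK c two(3) by blast
  have dom: "c \<notin> S \<and> (\<exists>p\<in>S. (c, p) \<in> parcs H)"
    if abc: "a \<in> K" "b \<in> K" "c \<in> K" "a \<noteq> b" "c \<noteq> a" "c \<noteq> b" and S: "induced_path H a b S" for a b c S
    using same_layer(3)[OF g abc(4) abc(6)[symmetric] abc(5)[symmetric] _ _ _ _ S] nc[of a b c] K abc
    by blast
  have nonadj: "(a, b) \<notin> parcs H" if ab: "a \<in> K" "b \<in> K" for a b
  proof (cases "a = b")
    case True
    then show ?thesis using H.no_loops' by blast
  next
    case False
    obtain d where d: "d \<in> K" "d \<noteq> a" "d \<noteq> b" using third by metis
    show ?thesis
      by (rule same_layer(2)[OF g False, of d]) (use nc[OF ab d(1)] K ab d False in auto)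
  qed
  from K ge3 nonadj dom obtain p where p: "p \<in> pverts H" "K \<subseteq> nbhd H p"
    by (rule H.dominated_set_in_neighbourhood)
  have "out_arcs (with_proj H) p = {p} \<times> nbhd H p"
    by (auto simp: out_arcs_def nbhd_def)
  then have deg: "out_degree (with_proj H) p = card (nbhd H p)"
    by (simp add: out_degree_def card_cartesian_product_singleton)
  have "nbhd H p \<subseteq> pverts H" using H.in_arcsD2 by (auto simp: nbhd_def)
  then have "card K \<le> card (nbhd H p)"
    using p(2) H.pair_finite_verts finite_subset card_mono by metis
  also have "\<dots> \<le> max_degree H"
    unfolding max_degree_def deg[symmetric] using p(1) H.pair_finite_verts by (intro Max_ge) auto
  finally show ?thesis
    using leaf cardK by (auto simp: simplicial_indicator_def)
qed

lemma shared_coordinate: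
  assumes V: "x \<in> pverts X" "y \<in> pverts X" "z \<in> pverts X" and nX: "\<not> collinear X x y z"
  shows "fst x = fst y \<or> fst y = fst z \<or> fst x = fst z \<or> snd x = snd y \<or> snd y = snd z \<or> snd x = snd z"
proof (rule ccontr)
  assume "\<not> ?thesis"
  then show False
    using distinct_coordinates[of "fst x" "fst y" "fst z" "snd x" "snd y" "snd z"] V nX
    by (simp add: mem_Times_iff)
qed

end

lemma (in pair_graph) monophonic_position_set_noncollinear:
  assumes "monophonic_position_set G M" "x \<in> M" "y \<in> M" "z \<in> M" "x \<noteq> y" "y \<noteq> z" "x \<noteq> z"
  shows "\<not> collinear G x y z"
proof
  assume "collinear G x y z"
  then obtain u v S where S: "induced_path G u v S" "{x, y, z} \<subseteq> S"
    unfolding collinear_def by blast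
  obtain p where "monophonic_path G p" "set p = S"
    using induced_path_monophonic[OF S(1)] by blast
  then show False using assms S(2) unfolding monophonic_position_set_def by blast
qed

theorem theorem3p18:
  fixes G :: "'a pair_pre_digraph" and H :: "'b pair_pre_digraph"
  assumes "pair_graph G" and "pair_graph H"
    and "Digraph_Component.connected (with_proj G)"
    and "Digraph_Component.connected (with_proj H)"
    and "triangle_free G" and "triangle_free H"
    and "card (pverts G) \<ge> 3" and "card (pverts H) \<ge> 3"
  shows "mp_number (cartesian_product G H)
    \<le> Max {2, simplicial_indicator G * max_degree H, simplicial_indicator H * max_degree G}"
proof -
  interpret two_graphs G H
    using assms by (intro two_graphs.intro triangle_free_connected.intro
      triangle_free_connected_axioms.intro)
  interpret s: two_graphs H G by (rule swapped)
  obtain M where M: "monophonic_position_set X M" "card M = mp_number X"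
    using mp_number_attained(1)[OF product_graph] by blast
  note noncol = pair_graph.monophonic_position_set_noncollinear[OF product_graph M(1)]
  have MV: "M \<subseteq> pverts X" using M(1) by (simp add: monophonic_position_set_def)
  have "card M \<le> 2 \<or> card M \<le> simplicial_indicator G * max_degree H \<or>
    card M \<le> simplicial_indicator H * max_degree G"
  proof (cases "card M \<le> 2")
    case False
    then have ge3: "card M \<ge> 3" by simp
    then obtain T where "T \<subseteq> M" "card T = 3" by (meson obtain_subset_with_card_n)
    then obtain x y z where xyz: "x \<in> M" "y \<in> M" "z \<in> M" "x \<noteq> y" "y \<noteq> z" "x \<noteq> z"
      by (auto simp: card_3_iff)
    have "\<exists>u\<in>M. \<exists>v\<in>M. u \<noteq> v \<and> (fst u = fst v \<or> snd u = snd v)"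
      using shared_coordinate[of x y z] noncol[OF xyz] xyz MV by blast
    then obtain g h k l where uv: "(g, h) \<in> M" "(k, l) \<in> M" "(g, h) \<noteq> (k, l)" "g = k \<or> h = l"
      by (metis prod.collapse)
    show ?thesis
    proof (cases "g = k")
      case True
      then have "(g, h) \<in> M" "(g, l) \<in> M" "h \<noteq> l" using uv by auto
      then show ?thesis using card_le_max_degree[OF MV ge3 noncol] by blast
    next
      case False
      then have *: "(h, g) \<in> prod.swap ` M" "(h, k) \<in> prod.swap ` M" "g \<noteq> k"
        using uv by force+
      have card_swap: "card (prod.swap ` M) = card M" by (simp add: card_image)
      have "prod.swap ` M \<subseteq> pverts s.X" using MV by auto
      moreover have "card (prod.swap ` M) \<ge> 3" using card_swap ge3 by simp
      moreover have "\<not> collinear s.X a b c"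
        if abc: "a \<in> prod.swap ` M" "b \<in> prod.swap ` M" "c \<in> prod.swap ` M" "a \<noteq> b" "b \<noteq> c" "a \<noteq> c"
        for a b c
      proof
        assume col: "collinear s.X a b c"
        obtain a1 a2 b1 b2 c1 c2 where e: "a = (a1, a2)" "b = (b1, b2)" "c = (c1, c2)"
          by (cases a; cases b; cases c)
        have "collinear X (a2, a1) (b2, b1) (c2, c1)" using collinear_swap col unfolding e by metis
        moreover have "(a2, a1) \<in> M" "(b2, b1) \<in> M" "(c2, c1) \<in> M" using abc(1-3) e by auto
        ultimately show False using noncol abc(4-6) unfolding e by blast
      qed
      ultimately have "card (prod.swap ` M) \<le> simplicial_indicator H * max_degree G"
        using * by (rule s.card_le_max_degree)
      then show ?thesis using card_swap by simp
    qed
  qed simp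
  then show ?thesis using M(2) by (auto simp: le_max_iff_disj)
qed

end
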